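(* Let $L$ be a quasicontinuous domain. Then $L$ is a $\mathcal Q_{\sigma}$-unique poset; that is, for every poset $M$, if $(\mathcal Q(L),\supseteq)$ and $(\mathcal Q(M),\supseteq)$ are order isomorphic, then $L$ and $M$ are order isomorphic.
   Context: For a poset $P$ and $A\subseteq P$, ${\uparrow}A=\{x\in P: x\ge a \text{ for some } a\in A\}$ and ${\uparrow}x={\uparrow}\{x\}$; $A$ is an upper set if $A={\uparrow}A$. A subset $D\subseteq P$ is directed if every finite subset of $D$ (including the empty one) has an upper bound in $D$. A dcpo is a poset in which every directed subset has a supremum. A subset $U\subseteq P$ is Scott open if $U={\uparrow}U$ and for every directed $D\subseteq P$ whose supremum exists, $\sup D\in U$ implies $D\cap U\ne\emptyset$; the Scott open sets form the Scott topology. $\mathcal Q(P)$ denotes the set of all compact saturated subsets of $P$ with respect to the Scott topology (saturated means upper set; compact means every open cover has a finite subcover; the empty set is included), ordered by reverse inclusion. For subsets $G,H$ of a dcpo $L$, the Smyth order is $G\sqsubseteq H \iff H\subseteq{\uparrow}G$, and $G\ll H$ means: for every directed $D\subseteq L$, $\sup D\in{\uparrow}H$ implies $d\in{\uparrow}G$ for some $d\in D$; write $G\ll x$ for $G\ll\{x\}$. A dcpo $L$ is a quasicontinuous domain if for each $x\in L$ the family $\mathrm{fin}(x)=\{F: F\text{ is finite},\ F\ll x\}$ is directed with respect to the Smyth order and ${\uparrow}x=\bigcap\{{\uparrow}F: F\in\mathrm{fin}(x)\}$. *)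

theory Defs
  imports "HOL-Analysis.Abstract_Topology"
begin

text \<open>
  A poset is a relation \<open>r\<close> with \<open>Partial_order r\<close>; its carrier is \<open>Field r\<close> (possibly empty)
  and \<open>(x, y) \<in> r\<close> means \<open>x \<le> y\<close>.  The up-closure of \<open>A \<subseteq> Field r\<close> is the relational image
  \<open>r `` A\<close>, so that \<open>r `` A = A\<close> says that \<open>A\<close> is an upper set of the poset.
\<close>

definition directed :: "'a rel \<Rightarrow> 'a set \<Rightarrow> bool" where
  "directed r D \<longleftrightarrow> D \<subseteq> Field r \<and> (\<forall>F. finite F \<and> F \<subseteq> D \<longrightarrow> (\<exists>u\<in>D. \<forall>x\<in>F. (x, u) \<in> r))"

definition is_sup :: "'a rel \<Rightarrow> 'a set \<Rightarrow> 'a \<Rightarrow> bool" where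
  "is_sup r D s \<longleftrightarrow> s \<in> Above r D \<and> (\<forall>u\<in>Above r D. (s, u) \<in> r)"

definition dcpo :: "'a rel \<Rightarrow> bool" where
  "dcpo r \<longleftrightarrow> Partial_order r \<and> (\<forall>D. directed r D \<longrightarrow> (\<exists>s. is_sup r D s))"

definition scott_open :: "'a rel \<Rightarrow> 'a set \<Rightarrow> bool" where
  "scott_open r U \<longleftrightarrow> r `` U = U \<and>
     (\<forall>D s. directed r D \<and> is_sup r D s \<and> s \<in> U \<longrightarrow> D \<inter> U \<noteq> {})"

text \<open>
  The function \<open>topology\<close> is meaningful only on families satisfying \<open>istopology\<close>;
  \<open>openin_scott_topology\<close> below discharges this.
\<close>

definition scott_topology :: "'a rel \<Rightarrow> 'a topology" where
  "scott_topology r = topology (scott_open r)"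

lemma scott_open_subset_Field:
  assumes "scott_open r U"
  shows "U \<subseteq> Field r"
proof
  fix x assume "x \<in> U"
  then have "x \<in> r `` U"
    using assms by (simp add: scott_open_def)
  then show "x \<in> Field r"
    by (auto intro: FieldI2)
qed

lemma istopology_scott_open:
  assumes "Partial_order r"
  shows "istopology (scott_open r)"
  unfolding istopology_def
proof (intro conjI allI impI)
  have refl: "(x, x) \<in> r" if "x \<in> Field r" for x
    using assms that by (simp add: order_on_defs refl_on_def)
  fix U V assume U: "scott_open r U" and V: "scott_open r V"
  have up: "r `` U = U" "r `` V = V"
    using U V by (simp_all add: scott_open_def)
  show "scott_open r (U \<inter> V)"
    unfolding scott_open_def
  proof (intro conjI allI impI)
    show "r `` (U \<inter> V) = U \<inter> V"
    proof
      show "r `` (U \<inter> V) \<subseteq> U \<inter> V"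
        using Image_Int_subset[of r U V] up by simp
      show "U \<inter> V \<subseteq> r `` (U \<inter> V)"
      proof
        fix x assume x: "x \<in> U \<inter> V"
        then have "(x, x) \<in> r"
          using refl scott_open_subset_Field[OF U] by auto
        with x show "x \<in> r `` (U \<inter> V)"
          by (rule ImageI[rotated])
      qed
    qed
  next
    fix D s assume D: "directed r D \<and> is_sup r D s \<and> s \<in> U \<inter> V"
    then have "D \<inter> U \<noteq> {}" "D \<inter> V \<noteq> {}"
      using U V by (simp_all add: scott_open_def) blast+
    then obtain a b where ab: "a \<in> D" "a \<in> U" "b \<in> D" "b \<in> V"
      by auto
    have "finite {a, b} \<and> {a, b} \<subseteq> D"
      using ab by simp
    with D have "\<exists>u\<in>D. \<forall>x\<in>{a, b}. (x, u) \<in> r"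
      by (simp only: directed_def)
    then obtain u where u: "u \<in> D" "(a, u) \<in> r" "(b, u) \<in> r"
      by auto
    have "u \<in> U" "u \<in> V"
      using ImageI[OF u(2) ab(2)] ImageI[OF u(3) ab(4)] up by simp_all
    with u(1) show "D \<inter> (U \<inter> V) \<noteq> {}"
      by auto
  qed
next
  fix \<K> assume \<K>: "\<forall>K\<in>\<K>. scott_open r K"
  show "scott_open r (\<Union>\<K>)"
    unfolding scott_open_def
  proof (intro conjI allI impI)
    show "r `` \<Union>\<K> = \<Union>\<K>"
      using \<K> Image_UN[of r id \<K>] by (simp add: scott_open_def)
  next
    fix D s assume D: "directed r D \<and> is_sup r D s \<and> s \<in> \<Union>\<K>"
    then obtain K where K: "K \<in> \<K>" "s \<in> K"
      by auto
    then have "D \<inter> K \<noteq> {}"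
      using \<K> D by (simp add: scott_open_def) blast
    with K(1) show "D \<inter> \<Union>\<K> \<noteq> {}"
      by auto
  qed
qed

lemma openin_scott_topology:
  assumes "Partial_order r"
  shows "openin (scott_topology r) U \<longleftrightarrow> scott_open r U"
  by (simp add: scott_topology_def istopology_scott_open[OF assms])

lemma topspace_scott_topology:
  assumes "Partial_order r"
  shows "topspace (scott_topology r) = Field r"
proof -
  have "r `` Field r = Field r"
    using assms by (auto simp: order_on_defs refl_on_def Field_def)
  moreover have "D \<inter> Field r \<noteq> {}" if "directed r D" for D
  proof -
    have "D \<subseteq> Field r" "D \<noteq> {}"
      using that unfolding directed_def by auto
    then show ?thesis by blast
  qed
  ultimately have "scott_open r (Field r)"
    unfolding scott_open_def by blast
  then show ?thesis
    unfolding topspace_def openin_scott_topology[OF assms]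
    using scott_open_subset_Field[of r] by (intro equalityI Sup_least Sup_upper) simp_all
qed

definition compact_saturated :: "'a rel \<Rightarrow> 'a set set" where
  "compact_saturated r = {K. compactin (scott_topology r) K \<and> r `` K = K}"

definition \<Q> :: "'a rel \<Rightarrow> 'a set rel" where
  "\<Q> r = {(K, K'). K \<in> compact_saturated r \<and> K' \<in> compact_saturated r \<and> K \<supseteq> K'}"

lemma Field_\<Q>: "Field (\<Q> r) = compact_saturated r"
  by (auto simp: \<Q>_def Field_def)

definition smyth :: "'a rel \<Rightarrow> 'a set rel" where
  "smyth r = {(G, H). G \<subseteq> Field r \<and> H \<subseteq> Field r \<and> H \<subseteq> r `` G}"

definition way_below :: "'a rel \<Rightarrow> 'a set \<Rightarrow> 'a set \<Rightarrow> bool" where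
  "way_below r G H \<longleftrightarrow>
     (\<forall>D s. directed r D \<and> is_sup r D s \<and> s \<in> r `` H \<longrightarrow> (\<exists>d\<in>D. d \<in> r `` G))"

definition fin :: "'a rel \<Rightarrow> 'a \<Rightarrow> 'a set set" where
  "fin r x = {F. finite F \<and> F \<subseteq> Field r \<and> way_below r F {x}}"

text \<open>
  Directedness of \<open>fin r x\<close> forces it to be nonempty, so the intersection below never
  degenerates to \<open>UNIV\<close>.
\<close>

definition quasicontinuous_domain :: "'a rel \<Rightarrow> bool" where
  "quasicontinuous_domain r \<longleftrightarrow> dcpo r \<and>
     (\<forall>x\<in>Field r. directed (smyth r) (fin r x) \<and> r `` {x} = (\<Inter>F\<in>fin r x. r `` F))"

text \<open>
  Despite its origin in the theory of well-orders, \<open>iso\<close> is order isomorphism for arbitrary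
  relations; see \<open>iso_iff2\<close>.
\<close>

definition order_isomorphic :: "'a rel \<Rightarrow> 'b rel \<Rightarrow> bool" where
  "order_isomorphic r s \<longleftrightarrow> (\<exists>f. iso r s f)"

lemma order_isomorphic_iff:
  "order_isomorphic r s \<longleftrightarrow> (\<exists>f. bij_betw f (Field r) (Field s) \<and>
     (\<forall>x\<in>Field r. \<forall>y\<in>Field r. (x, y) \<in> r \<longleftrightarrow> (f x, f y) \<in> s))"
  by (simp add: order_isomorphic_def iso_iff2)

end

theory Submission
  imports Defs
begin

text \<open>
  The idea is to recover the points of both posets from the order of their compact saturated
  sets, by recognising the principal filters \<open>\<up>x\<close>.  Let \<open>\<phi>\<close> be an order isomorphism from
  \<open>\<Q> L\<close> to \<open>\<Q> M\<close>.

  A principal filter is prime: if a finite union of upper sets contains \<open>\<up>x\<close>, then the member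
  containing \<open>x\<close> contains all of \<open>\<up>x\<close>.  Finite unions are the finite meets of \<open>\<Q> M\<close>, so
  primality is an order property and passes through \<open>\<phi>\<close>.  In a quasicontinuous domain,
  conversely, every prime compact saturated set is principal
  (\<open>prime_compact_saturated_is_principal\<close>); this rests on the Scott openness of the sets
  \<open>{y. F \<lless> y}\<close> for finite \<open>F\<close> and hence on Rudin's lemma.  So for each \<open>m\<close> in \<open>M\<close> there is
  \<open>g m\<close> in \<open>L\<close> with \<open>\<phi> (\<up>(g m)) = \<up>m\<close>, and \<open>g\<close> is an order embedding of \<open>M\<close> into \<open>L\<close>.

  It remains to see that \<open>g\<close> is onto.  Primality alone does not give this: \<open>M\<close> is an arbitrary
  poset, and a prime of \<open>\<Q> M\<close> has no evident least element.  Instead, \<open>g\<close> turns out to be Scott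
  continuous (\<open>scott_continuous_principal_transfer\<close>).  Given \<open>l\<close> in \<open>L\<close>, let
  \<open>K = \<phi> (\<up>l)\<close>.  By continuity \<open>g ` K\<close> is compact, so its up-closure \<open>A\<close> belongs to \<open>\<Q> L\<close>.
  Every \<open>m \<in> K\<close> satisfies \<open>\<up>m = \<phi> (\<up>(g m)) \<subseteq> \<phi> A\<close>, whence \<open>\<phi> (\<up>l) = K \<subseteq> \<phi> A\<close> and
  \<open>\<up>l \<subseteq> A\<close>.  So \<open>l\<close> lies above some \<open>g m\<close> with \<open>m \<in> K\<close>, while \<open>\<up>m \<subseteq> K\<close> puts \<open>g m\<close>
  above \<open>l\<close>; thus \<open>l = g m\<close>.
\<close>

section \<open>Directed sets and compact saturated sets\<close>

lemma Partial_orderD: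
  assumes "Partial_order r"
  shows Partial_order_refl: "x \<in> Field r \<Longrightarrow> (x, x) \<in> r"
    and Partial_order_trans: "(x, y) \<in> r \<Longrightarrow> (y, z) \<in> r \<Longrightarrow> (x, z) \<in> r"
    and Partial_order_antisym: "(x, y) \<in> r \<Longrightarrow> (y, x) \<in> r \<Longrightarrow> x = y"
  using assms by (auto simp: order_on_defs refl_on_def dest: transD antisymD)

lemma upper_setI:
  assumes "Partial_order r" "A \<subseteq> Field r"
    and "\<And>x y. x \<in> A \<Longrightarrow> (x, y) \<in> r \<Longrightarrow> y \<in> A"
  shows "r `` A = A"
proof
  show "r `` A \<subseteq> A" using assms(3) by blast
  show "A \<subseteq> r `` A"
  proof
    fix x assume x: "x \<in> A"
    then have "(x, x) \<in> r" using Partial_order_refl[OF assms(1)] assms(2) by blast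
    with x show "x \<in> r `` A" by blast
  qed
qed

lemma Image_Image_eq:
  assumes "Partial_order r"
  shows "r `` (r `` A) = r `` A"
  using Partial_order_trans[OF assms] by (intro upper_setI[OF assms]) (auto intro: FieldI2)

lemma upper_set_Union:
  assumes "\<And>A. A \<in> \<A> \<Longrightarrow> r `` A = A"
  shows "r `` \<Union>\<A> = \<Union>\<A>"
proof -
  have "r `` \<Union>\<A> = (\<Union>A\<in>\<A>. r `` A)" by blast
  also have "\<dots> = \<Union>\<A>" using assms by simp
  finally show ?thesis .
qed

lemma principal_subset_iff:
  assumes "Partial_order r" "x \<in> Field r"
  shows "r `` {x} \<subseteq> r `` {y} \<longleftrightarrow> (y, x) \<in> r"
  using Partial_order_refl[OF assms] Partial_order_trans[OF assms(1)] by blast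

lemma principal_subset_upper:
  assumes "r `` A = A" "x \<in> A"
  shows "r `` {x} \<subseteq> A"
  using assms by blast

text \<open>
  Directedness is defined by bounds of all finite subsets; the case of two elements is what one
  verifies in practice.  It is stated for transitive relations since it is also applied to the
  Smyth preorder, which is not antisymmetric.
\<close>

lemma directedI:
  assumes "trans r" "D \<subseteq> Field r" "D \<noteq> {}"
    and pair: "\<And>x y. x \<in> D \<Longrightarrow> y \<in> D \<Longrightarrow> \<exists>z\<in>D. (x, z) \<in> r \<and> (y, z) \<in> r"
  shows "directed r D"
proof -
  have "\<exists>u\<in>D. \<forall>x\<in>F. (x, u) \<in> r" if "finite F" "F \<subseteq> D" for F
    using that
  proof (induction F)
    case empty
    then show ?case using \<open>D \<noteq> {}\<close> by blast
  next
    case (insert a F)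
    then obtain u where u: "u \<in> D" "\<forall>x\<in>F. (x, u) \<in> r" by auto
    with pair[of a u] insert.prems obtain z where "z \<in> D" "(a, z) \<in> r" "(u, z) \<in> r" by auto
    with u show ?case using \<open>trans r\<close> by (metis insert_iff transE)
  qed
  with assms show ?thesis unfolding directed_def by blast
qed

lemma directed_pairE:
  assumes "directed r D" "x \<in> D" "y \<in> D"
  obtains z where "z \<in> D" "(x, z) \<in> r" "(y, z) \<in> r"
proof -
  have "finite {x, y} \<and> {x, y} \<subseteq> D" using assms by simp
  with assms(1) show ?thesis using that unfolding directed_def by (metis insertCI)
qed

lemma directed_nonempty:
  assumes "directed r D"
  shows "D \<noteq> {}"
  using assms unfolding directed_def by blast

lemma directed_image:
  assumes "directed r D" "trans s" "f ` D \<subseteq> Field s"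
    and "\<And>x y. (x, y) \<in> r \<Longrightarrow> x \<in> D \<Longrightarrow> y \<in> D \<Longrightarrow> (f x, f y) \<in> s"
  shows "directed s (f ` D)"
proof (rule directedI)
  show "f ` D \<noteq> {}" using directed_nonempty[OF assms(1)] by simp
  show "\<exists>z\<in>f ` D. (x, z) \<in> s \<and> (y, z) \<in> s" if "x \<in> f ` D" "y \<in> f ` D" for x y
  proof -
    from that obtain a b where "x = f a" "y = f b" and ab: "a \<in> D" "b \<in> D" by blast
    moreover from directed_pairE[OF assms(1) ab]
    obtain c where "c \<in> D" "(a, c) \<in> r" "(b, c) \<in> r" .
    ultimately show ?thesis using assms(4) by blast
  qed
qed (use assms in auto)

text \<open>
  Scott open sets are upper sets, so a family of them covering \<open>C\<close> already covers the
  up-closure of \<open>C\<close>.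
\<close>

lemma compactin_up_closure:
  assumes r: "Partial_order r" and C: "compactin (scott_topology r) C"
  shows "r `` C \<in> compact_saturated r"
proof -
  have "C \<subseteq> r `` C"
    using compactin_subset_topspace[OF C] Partial_order_refl[OF r]
    by (auto simp: topspace_scott_topology[OF r])
  have "compactin (scott_topology r) (r `` C)"
    unfolding compactin_def
  proof (intro conjI allI impI)
    show "r `` C \<subseteq> topspace (scott_topology r)"
      by (auto simp: topspace_scott_topology[OF r] intro: FieldI2)
    fix \<U> assume \<U>: "Ball \<U> (openin (scott_topology r)) \<and> r `` C \<subseteq> \<Union>\<U>"
    with \<open>C \<subseteq> r `` C\<close> C obtain \<F> where \<F>: "finite \<F>" "\<F> \<subseteq> \<U>" "C \<subseteq> \<Union>\<F>"
      unfolding compactin_def by (metis subset_trans)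
    have "r `` U = U" if "U \<in> \<F>" for U
    proof -
      have "scott_open r U" using that \<F>(2) \<U> openin_scott_topology[OF r] by blast
      then show ?thesis by (simp add: scott_open_def)
    qed
    then have "r `` \<Union>\<F> = \<Union>\<F>" by (rule upper_set_Union)
    then have "r `` C \<subseteq> \<Union>\<F>" using Image_mono[OF order_refl \<F>(3), of r] by simp
    with \<F> show "\<exists>\<F>. finite \<F> \<and> \<F> \<subseteq> \<U> \<and> r `` C \<subseteq> \<Union>\<F>" by blast
  qed
  then show ?thesis by (simp add: compact_saturated_def Image_Image_eq[OF r])
qed

lemma finite_up_closure_compact_saturated:
  assumes "Partial_order r" "finite F" "F \<subseteq> Field r"
  shows "r `` F \<in> compact_saturated r"
  using assms by (intro compactin_up_closure finite_imp_compactin) (simp_all add: topspace_scott_topology)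

lemma Union_compact_saturated:
  assumes "finite \<A>" "\<A> \<subseteq> compact_saturated r"
  shows "\<Union>\<A> \<in> compact_saturated r"
proof -
  have "compactin (scott_topology r) (\<Union>\<A>)"
    using assms by (intro compactin_Union) (auto simp: compact_saturated_def)
  moreover have "r `` \<Union>\<A> = \<Union>\<A>"
    using assms(2) by (intro upper_set_Union) (auto simp: compact_saturated_def)
  ultimately show ?thesis by (simp add: compact_saturated_def)
qed

lemma compact_saturated_upper:
  "K \<in> compact_saturated r \<Longrightarrow> r `` K = K"
  by (simp add: compact_saturated_def)

lemma compact_saturated_subset_Field:
  assumes "Partial_order r" "K \<in> compact_saturated r"
  shows "K \<subseteq> Field r"
  using assms(2) compactin_subset_topspace[of "scott_topology r" K]
  by (simp add: compact_saturated_def topspace_scott_topology[OF assms(1)])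

section \<open>Rudin's lemma\<close>

text \<open>
  Rudin's lemma, in a form with an upper set \<open>U\<close> to be avoided.  Among the upper sets
  containing \<open>U\<close> but no member of \<open>\<G>\<close> choose a maximal one, \<open>W\<close>; finiteness of the members
  of \<open>\<G>\<close> keeps this condition valid for unions of chains.  The points of \<open>\<Union>\<G>\<close> outside \<open>W\<close>
  are directed: by maximality, adding \<open>\<up>x\<close> or \<open>\<up>y\<close> to \<open>W\<close> engulfs some member of \<open>\<G>\<close>, and a
  common refinement of these two members has a point outside \<open>W\<close>, which is then above both
  \<open>x\<close> and \<open>y\<close>.
\<close>

lemma rudin:
  assumes r: "Partial_order r" and \<G>: "directed (smyth r) \<G>"
    and fin: "\<And>G. G \<in> \<G> \<Longrightarrow> finite G"
    and U: "r `` U = U" "\<And>G. G \<in> \<G> \<Longrightarrow> \<not> G \<subseteq> U"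
  shows "\<exists>D. directed r D \<and> D \<inter> U = {} \<and> (\<forall>G\<in>\<G>. D \<inter> G \<noteq> {})"
proof -
  define \<W> where "\<W> = {W. U \<subseteq> W \<and> r `` W = W \<and> (\<forall>G\<in>\<G>. \<not> G \<subseteq> W)}"
  have "\<exists>W\<in>\<W>. \<forall>X\<in>\<W>. W \<subseteq> X \<longrightarrow> X = W"
  proof (rule subset_Zorn_nonempty)
    have "U \<in> \<W>" using U by (simp add: \<W>_def)
    then show "\<W> \<noteq> {}" by blast
  next
    fix \<C> assume \<C>: "\<C> \<noteq> {}" "subset.chain \<W> \<C>"
    have sub: "\<C> \<subseteq> \<W>" using \<C>(2) unfolding subset_chain_def by (rule conjunct1)
    have "\<not> G \<subseteq> \<Union>\<C>" if G: "G \<in> \<G>" for G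
    proof
      assume "G \<subseteq> \<Union>\<C>"
      then obtain W where "W \<in> \<C>" "G \<subseteq> W"
        using finite_subset_Union_chain[OF fin[OF G] _ \<C>] by blast
      with G sub show False by (auto simp: \<W>_def)
    qed
    moreover have "r `` \<Union>\<C> = \<Union>\<C>"
      using sub by (intro upper_set_Union) (auto simp: \<W>_def)
    moreover have "U \<subseteq> \<Union>\<C>"
    proof -
      obtain W where "W \<in> \<C>" using \<C>(1) by blast
      with sub have "U \<subseteq> W" by (auto simp: \<W>_def)
      with \<open>W \<in> \<C>\<close> show ?thesis by blast
    qed
    ultimately show "\<Union>\<C> \<in> \<W>" by (simp add: \<W>_def)
  qed
  then obtain W where W: "U \<subseteq> W" "r `` W = W" "\<And>G. G \<in> \<G> \<Longrightarrow> \<not> G \<subseteq> W"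
    and max: "\<And>X. X \<in> \<W> \<Longrightarrow> W \<subseteq> X \<Longrightarrow> X = W"
    by (auto simp: \<W>_def)
  define D where "D = \<Union>\<G> - W"
  have sub: "G \<subseteq> Field r" if "G \<in> \<G>" for G
  proof -
    have "G \<in> Field (smyth r)" using \<G> that by (auto simp: directed_def)
    then show ?thesis by (auto simp: Field_def smyth_def)
  qed
  have ex: "\<exists>G\<in>\<G>. G \<subseteq> W \<union> r `` {x}" if x: "x \<in> D" for x
  proof (rule ccontr)
    assume "\<not> ?thesis"
    moreover have "r `` (W \<union> r `` {x}) = W \<union> r `` {x}"
      using W(2) Image_Image_eq[OF r, of "{x}"] by (simp add: Image_Un)
    ultimately have "W \<union> r `` {x} \<in> \<W>" using W(1) by (auto simp: \<W>_def)
    then have "r `` {x} \<subseteq> W" using max by blast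
    moreover have "(x, x) \<in> r" using x sub Partial_order_refl[OF r] by (auto simp: D_def)
    ultimately show False using x by (auto simp: D_def)
  qed
  have meets: "D \<inter> G \<noteq> {}" if "G \<in> \<G>" for G
    using W(3)[OF that] that by (auto simp: D_def)
  have "directed r D"
  proof (rule directedI)
    show "trans r" using r by (simp add: order_on_defs)
    show "D \<subseteq> Field r" using sub by (auto simp: D_def)
    show "D \<noteq> {}" using directed_nonempty[OF \<G>] meets by blast
    fix x y assume "x \<in> D" "y \<in> D"
    then obtain A B where A: "A \<in> \<G>" "A \<subseteq> W \<union> r `` {x}" and B: "B \<in> \<G>" "B \<subseteq> W \<union> r `` {y}"
      using ex by meson
    obtain H where H: "H \<in> \<G>" "(A, H) \<in> smyth r" "(B, H) \<in> smyth r"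
      by (rule directed_pairE[OF \<G> A(1) B(1)])
    obtain h where h: "h \<in> H" "h \<notin> W" using W(3) H(1) by blast
    have "h \<in> W \<union> r `` {z}" if C: "(C, H) \<in> smyth r" "C \<subseteq> W \<union> r `` {z}" for C z
    proof -
      obtain c where "c \<in> C" "(c, h) \<in> r" using C(1) h(1) by (auto simp: smyth_def)
      then show ?thesis using C(2) W(2) Partial_order_trans[OF r] by blast
    qed
    then have "(x, h) \<in> r" "(y, h) \<in> r" using H A B h(2) by blast+
    moreover have "h \<in> D" using h H(1) by (auto simp: D_def)
    ultimately show "\<exists>z\<in>D. (x, z) \<in> r \<and> (y, z) \<in> r" by blast
  qed
  moreover have "D \<inter> U = {}" using W(1) by (auto simp: D_def)
  ultimately show ?thesis using meets by blast
qed

section \<open>Quasicontinuous domains\<close>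

lemma way_below_mono:
  assumes "Partial_order r" "way_below r F {x}" "(x, y) \<in> r"
  shows "way_below r F {y}"
  using assms(2) Partial_order_trans[OF assms(1,3)] unfolding way_below_def by blast

text \<open>
  The singleton \<open>{x}\<close> is directed with supremum \<open>x\<close>.
\<close>

lemma way_below_imp_above:
  assumes r: "Partial_order r" and "way_below r F {x}" "x \<in> Field r"
  shows "x \<in> r `` F"
proof -
  have xx: "(x, x) \<in> r" using Partial_order_refl[OF r assms(3)] .
  then have "directed r {x}" "is_sup r {x} x" "x \<in> r `` {x}"
    using assms(3) by (auto simp: directed_def is_sup_def Above_def)
  then show ?thesis using assms(2) unfolding way_below_def by blast
qed

lemma fin_mono:
  assumes "Partial_order r" "(x, y) \<in> r"
  shows "fin r x \<subseteq> fin r y"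
  using way_below_mono[OF assms(1) _ assms(2)] by (auto simp: fin_def)

lemma quasicontinuous_domainD:
  assumes "quasicontinuous_domain r"
  shows "Partial_order r"
    and "\<And>D. directed r D \<Longrightarrow> \<exists>s. is_sup r D s"
    and "\<And>x. x \<in> Field r \<Longrightarrow> directed (smyth r) (fin r x)"
    and "\<And>x. x \<in> Field r \<Longrightarrow> r `` {x} = (\<Inter>F\<in>fin r x. r `` F)"
  using assms by (auto simp: quasicontinuous_domain_def dcpo_def)

text \<open>
  The finite sets way below some member of \<open>D\<close> form a Smyth-directed family.  If one of them
  lies in \<open>\<up>F\<close>, then \<open>F\<close> is way below the corresponding \<open>d\<close>.  Otherwise Rudin's lemma gives a
  directed set \<open>E\<close> that meets all of them and avoids \<open>\<up>F\<close>.  Its supremum \<open>e\<close> lies above every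
  \<open>d \<in> D\<close>, as \<open>\<up>d\<close> is the intersection of the sets \<open>\<up>G\<close> with \<open>G \<lless> d\<close>; so \<open>s \<le> e\<close>, and
  \<open>F \<lless> s\<close> forces \<open>E\<close> into \<open>\<up>F\<close> after all.
\<close>

lemma way_below_inaccessible:
  assumes q: "quasicontinuous_domain r"
    and D: "directed r D" "is_sup r D s" and F: "way_below r F {s}"
  shows "\<exists>d\<in>D. way_below r F {d}"
proof -
  note r = quasicontinuous_domainD(1)[OF q]
  define \<G> where "\<G> = (\<Union>d\<in>D. fin r d)"
  have DF: "D \<subseteq> Field r" using D(1) by (simp add: directed_def)
  have tr: "trans (smyth r)"
  proof (rule transI)
    fix A B C assume AC: "(A, B) \<in> smyth r" "(B, C) \<in> smyth r"
    then have "r `` B \<subseteq> r `` A"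
      using Image_mono[OF order_refl, of B "r `` A" r] Image_Image_eq[OF r, of A]
      by (simp add: smyth_def)
    with AC show "(A, C) \<in> smyth r" by (auto simp: smyth_def)
  qed
  have \<G>: "directed (smyth r) \<G>"
  proof (rule directedI[OF tr])
    show "\<G> \<subseteq> Field (smyth r)"
      using quasicontinuous_domainD(3)[OF q] DF by (auto simp: \<G>_def directed_def)
    obtain d where d: "d \<in> D" using directed_nonempty[OF D(1)] by blast
    then have "fin r d \<noteq> {}"
      using directed_nonempty[OF quasicontinuous_domainD(3)[OF q, of d]] DF by blast
    then show "\<G> \<noteq> {}" using d by (auto simp: \<G>_def)
    fix A B assume "A \<in> \<G>" "B \<in> \<G>"
    then obtain a b where ab: "a \<in> D" "b \<in> D" "A \<in> fin r a" "B \<in> fin r b" by (auto simp: \<G>_def)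
    obtain c where c: "c \<in> D" "(a, c) \<in> r" "(b, c) \<in> r"
      by (rule directed_pairE[OF D(1) ab(1,2)])
    have AB: "A \<in> fin r c" "B \<in> fin r c"
      using ab(3,4) fin_mono[OF r c(2)] fin_mono[OF r c(3)] by blast+
    have "c \<in> Field r" using c(1) DF by blast
    then obtain C where "C \<in> fin r c" "(A, C) \<in> smyth r" "(B, C) \<in> smyth r"
      by (rule directed_pairE[OF quasicontinuous_domainD(3)[OF q] AB])
    with c(1) show "\<exists>C\<in>\<G>. (A, C) \<in> smyth r \<and> (B, C) \<in> smyth r" by (auto simp: \<G>_def)
  qed
  have "\<exists>G\<in>\<G>. G \<subseteq> r `` F"
  proof (rule ccontr)
    assume "\<not> ?thesis"
    then have "\<And>G. G \<in> \<G> \<Longrightarrow> \<not> G \<subseteq> r `` F" by blast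
    moreover have "\<And>G. G \<in> \<G> \<Longrightarrow> finite G" by (auto simp: \<G>_def fin_def)
    ultimately have "\<exists>E. directed r E \<and> E \<inter> r `` F = {} \<and> (\<forall>G\<in>\<G>. E \<inter> G \<noteq> {})"
      by (intro rudin[OF r \<G>] Image_Image_eq[OF r])
    then obtain E where E: "directed r E" "E \<inter> r `` F = {}" "\<And>G. G \<in> \<G> \<Longrightarrow> E \<inter> G \<noteq> {}"
      by blast
    obtain e where e: "is_sup r E e" using quasicontinuous_domainD(2)[OF q E(1)] by blast
    have "(d, e) \<in> r" if d: "d \<in> D" for d
    proof -
      have "e \<in> r `` G" if G: "G \<in> fin r d" for G
      proof -
        obtain g where "g \<in> E" "g \<in> G" using E(3) G d by (auto simp: \<G>_def)
        then show ?thesis using e by (auto simp: is_sup_def Above_def)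
      qed
      then have "e \<in> r `` {d}" using quasicontinuous_domainD(4)[OF q, of d] d DF by blast
      then show ?thesis by blast
    qed
    moreover have "e \<in> Field r" using e by (auto simp: is_sup_def Above_def)
    ultimately have "(s, e) \<in> r" using D(2) by (auto simp: is_sup_def Above_def)
    then have "\<exists>x\<in>E. x \<in> r `` F" using F E(1) e unfolding way_below_def by blast
    then show False using E(2) by blast
  qed
  then obtain G d where G: "d \<in> D" "G \<in> fin r d" "G \<subseteq> r `` F" by (auto simp: \<G>_def)
  then have "r `` G \<subseteq> r `` F"
    using Image_mono[OF order_refl G(3), of r] Image_Image_eq[OF r, of F] by simp
  then have "way_below r F {d}"
    using G(2) unfolding fin_def way_below_def by blast
  with G(1) show ?thesis by blast
qed

lemma scott_open_way_below:
  assumes q: "quasicontinuous_domain r"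
  shows "scott_open r {y \<in> Field r. way_below r F {y}}"
  unfolding scott_open_def
proof (intro conjI allI impI)
  note r = quasicontinuous_domainD(1)[OF q]
  show "r `` {y \<in> Field r. way_below r F {y}} = {y \<in> Field r. way_below r F {y}}"
    by (rule upper_setI[OF r]) (auto intro: way_below_mono[OF r] FieldI2)
  fix D s assume "directed r D \<and> is_sup r D s \<and> s \<in> {y \<in> Field r. way_below r F {y}}"
  then show "D \<inter> {y \<in> Field r. way_below r F {y}} \<noteq> {}"
    using way_below_inaccessible[OF q, of D s F] by (auto simp: directed_def)
qed

text \<open>
  If no \<open>x \<in> K\<close> is a lower bound of \<open>K\<close>, then each \<open>x \<in> K\<close> has a finite \<open>F \<lless> x\<close> whose
  up-closure \<open>\<up>F\<close> does not contain \<open>K\<close>.  The open sets \<open>{y. F \<lless> y} \<subseteq> \<up>F\<close> for such \<open>F\<close> cover \<open>K\<close>; by compactness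
  finitely many \<open>\<up>F\<close> cover \<open>K\<close>, and by primality one of them does, a contradiction.
\<close>

lemma prime_compact_saturated_is_principal:
  assumes q: "quasicontinuous_domain r" and K: "K \<in> compact_saturated r"
    and prime: "\<And>\<A>. finite \<A> \<Longrightarrow> \<A> \<subseteq> compact_saturated r \<Longrightarrow> K \<subseteq> \<Union>\<A> \<Longrightarrow> \<exists>A\<in>\<A>. K \<subseteq> A"
  shows "\<exists>x\<in>Field r. K = r `` {x}"
proof -
  note r = quasicontinuous_domainD(1)[OF q]
  have KF: "K \<subseteq> Field r" using compact_saturated_subset_Field[OF r K] .
  define V where "V F = {y \<in> Field r. way_below r F {y}}" for F
  define \<F> where "\<F> = {F. finite F \<and> F \<subseteq> Field r \<and> \<not> K \<subseteq> r `` F}"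
  have "\<not> K \<subseteq> \<Union>(V ` \<F>)"
  proof
    assume "K \<subseteq> \<Union>(V ` \<F>)"
    moreover have "Ball (V ` \<F>) (openin (scott_topology r))"
      using scott_open_way_below[OF q] by (auto simp: openin_scott_topology[OF r] V_def)
    ultimately obtain \<V> where "finite \<V>" "\<V> \<subseteq> V ` \<F>" "K \<subseteq> \<Union>\<V>"
      using K unfolding compact_saturated_def compactin_def by blast
    then obtain \<E> where \<E>: "finite \<E>" "\<E> \<subseteq> \<F>" "K \<subseteq> \<Union>(V ` \<E>)"
      by (metis finite_subset_image)
    have "V F \<subseteq> r `` F" for F using way_below_imp_above[OF r] by (auto simp: V_def)
    then have "\<Union>(V ` \<E>) \<subseteq> \<Union>((``) r ` \<E>)" by (rule UN_mono[OF order_refl])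
    with \<E>(3) have "K \<subseteq> \<Union>((``) r ` \<E>)" by (rule subset_trans)
    moreover have "(``) r ` \<E> \<subseteq> compact_saturated r"
      using \<E>(2) finite_up_closure_compact_saturated[OF r] by (auto simp: \<F>_def)
    ultimately have "\<exists>F\<in>\<E>. K \<subseteq> r `` F"
      using prime[of "(``) r ` \<E>"] \<E>(1) by auto
    then show False using \<E>(2) by (auto simp: \<F>_def)
  qed
  then obtain x where x: "x \<in> K" "\<And>F. F \<in> \<F> \<Longrightarrow> x \<notin> V F" by blast
  have "K \<subseteq> r `` F" if "F \<in> fin r x" for F
    using that x KF by (auto simp: \<F>_def V_def fin_def)
  then have "K \<subseteq> r `` {x}" using quasicontinuous_domainD(4)[OF q, of x] x(1) KF by blast
  moreover have "r `` {x} \<subseteq> K" by (rule principal_subset_upper[OF compact_saturated_upper[OF K] x(1)])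
  ultimately show ?thesis using x(1) KF by blast
qed

section \<open>Isomorphisms of the posets of compact saturated sets\<close>

text \<open>
  The preimage of \<open>\<up>m\<close> is prime because \<open>\<up>m\<close> is.  The hypothesis \<open>mono\<close> says that \<open>\<phi>\<close> is an
  order embedding for inclusion; the orders of \<open>\<Q> L\<close> and \<open>\<Q> M\<close> are both its reverse.
\<close>

lemma preimage_of_principal:
  assumes q: "quasicontinuous_domain L" and M: "Partial_order M"
    and bij: "bij_betw \<phi> (compact_saturated L) (compact_saturated M)"
    and mono: "\<And>A B. A \<in> compact_saturated L \<Longrightarrow> B \<in> compact_saturated L \<Longrightarrow> \<phi> A \<subseteq> \<phi> B \<longleftrightarrow> A \<subseteq> B"
    and m: "m \<in> Field M"
  shows "\<exists>l\<in>Field L. \<phi> (L `` {l}) = M `` {m}"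
proof -
  have "M `` {m} \<in> compact_saturated M"
    using finite_up_closure_compact_saturated[OF M, of "{m}"] m by simp
  then obtain P where P: "P \<in> compact_saturated L" "\<phi> P = M `` {m}"
    using bij by (metis bij_betw_iff_bijections)
  have "\<exists>A\<in>\<A>. P \<subseteq> A" if \<A>: "finite \<A>" "\<A> \<subseteq> compact_saturated L" "P \<subseteq> \<Union>\<A>" for \<A>
  proof -
    have in_M: "\<phi> ` \<A> \<subseteq> compact_saturated M" using \<A>(2) bij by (auto simp: bij_betw_def)
    then have "\<Union>(\<phi> ` \<A>) \<in> compact_saturated M"
      using Union_compact_saturated \<A>(1) by blast
    \<comment> \<open>\<open>C\<close> contains \<open>\<Union>\<A>\<close>, since \<open>\<phi> A \<subseteq> \<phi> C\<close> for all \<open>A \<in> \<A>\<close>.\<close>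
    then obtain C where C: "C \<in> compact_saturated L" "\<phi> C = \<Union>(\<phi> ` \<A>)"
      using bij by (metis bij_betw_iff_bijections)
    have "A \<subseteq> C" if "A \<in> \<A>" for A
      using that \<A>(2) C mono[of A C] by auto
    then have "P \<subseteq> C" using \<A>(3) by blast
    then have "M `` {m} \<subseteq> \<Union>(\<phi> ` \<A>)" using mono P C by metis
    then obtain A where A: "A \<in> \<A>" "m \<in> \<phi> A" using Partial_order_refl[OF M m] by blast
    then have "M `` {m} \<subseteq> \<phi> A"
      using in_M by (intro principal_subset_upper compact_saturated_upper) auto
    then show ?thesis using A(1) \<A>(2) P mono by (metis subsetD)
  qed
  then obtain l where "l \<in> Field L" "P = L `` {l}"
    using prime_compact_saturated_is_principal[OF q P(1)] by blast
  with P(2) show ?thesis by blast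
qed

text \<open>
  The map \<open>g\<close> preserves existing directed suprema.  Let \<open>s\<close> be the supremum of \<open>D\<close> in \<open>M\<close>
  and \<open>t\<close> that of \<open>g ` D\<close> in \<open>L\<close>.  Then \<open>\<phi> (\<up>t)\<close> lies in \<open>\<phi> (\<up>(g d)) = \<up>d\<close> for all
  \<open>d \<in> D\<close>, so it consists of upper bounds of \<open>D\<close> and is contained in \<open>\<up>s = \<phi> (\<up>(g s))\<close>;
  hence \<open>g s \<le> t\<close>.
\<close>

lemma scott_continuous_principal_transfer:
  assumes L: "dcpo L" and M: "Partial_order M"
    and mono: "\<And>A B. A \<in> compact_saturated L \<Longrightarrow> B \<in> compact_saturated L \<Longrightarrow> \<phi> A \<subseteq> \<phi> B \<longleftrightarrow> A \<subseteq> B"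
    and \<phi>: "\<phi> ` compact_saturated L \<subseteq> compact_saturated M"
    and g: "\<And>m. m \<in> Field M \<Longrightarrow> g m \<in> Field L"
      "\<And>m. m \<in> Field M \<Longrightarrow> \<phi> (L `` {g m}) = M `` {m}"
  shows "continuous_map (scott_topology M) (scott_topology L) g"
proof -
  have LP: "Partial_order L" using L by (simp add: dcpo_def)
  have cs: "L `` {x} \<in> compact_saturated L" if "x \<in> Field L" for x
    using finite_up_closure_compact_saturated[OF LP, of "{x}"] that by simp
  have g_mono: "(g a, g b) \<in> L" if "(a, b) \<in> M" for a b
  proof -
    have ab: "a \<in> Field M" "b \<in> Field M" using that by (auto intro: FieldI1 FieldI2)
    then have "\<phi> (L `` {g b}) \<subseteq> \<phi> (L `` {g a})"
      using that g(2) principal_subset_iff[OF M] by simp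
    then show ?thesis
      using ab mono cs g(1) principal_subset_iff[OF LP] by metis
  qed
  have "scott_open M {m \<in> Field M. g m \<in> U}" if U: "scott_open L U" for U
    unfolding scott_open_def
  proof (intro conjI allI impI)
    have "L `` U = U" using U by (simp add: scott_open_def)
    then show "M `` {m \<in> Field M. g m \<in> U} = {m \<in> Field M. g m \<in> U}"
      using g_mono by (intro upper_setI[OF M]) (auto intro: FieldI2)
    fix D s assume "directed M D \<and> is_sup M D s \<and> s \<in> {m \<in> Field M. g m \<in> U}"
    then have D: "directed M D" "is_sup M D s" "s \<in> Field M" "g s \<in> U" by auto
    have DF: "D \<subseteq> Field M" using D(1) by (simp add: directed_def)
    have gD: "directed L (g ` D)"
      using D(1) g_mono g(1) DF LP by (intro directed_image) (auto simp: order_on_defs)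
    then obtain t where t: "is_sup L (g ` D) t" using L by (auto simp: dcpo_def)
    then have tF: "t \<in> Field L" and ub: "\<And>d. d \<in> D \<Longrightarrow> (g d, t) \<in> L"
      by (auto simp: is_sup_def Above_def)
    have "\<phi> (L `` {t}) \<subseteq> M `` {s}"
    proof
      fix b assume b: "b \<in> \<phi> (L `` {t})"
      have "(d, b) \<in> M" if d: "d \<in> D" for d
      proof -
        have dF: "d \<in> Field M" using d DF by blast
        have "L `` {t} \<subseteq> L `` {g d}" using ub[OF d] principal_subset_iff[OF LP tF] by blast
        then have "\<phi> (L `` {t}) \<subseteq> M `` {d}" using mono cs tF g dF by metis
        then show ?thesis using b by blast
      qed
      moreover have "b \<in> Field M"
        using b \<phi> cs[OF tF] compact_saturated_subset_Field[OF M] by blast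
      ultimately show "b \<in> M `` {s}" using D(2) by (auto simp: is_sup_def Above_def)
    qed
    then have "L `` {t} \<subseteq> L `` {g s}" using mono cs tF g D(3) by metis
    then have "(g s, t) \<in> L" using principal_subset_iff[OF LP tF] by blast
    then have "t \<in> U" using D(4) \<open>L `` U = U\<close> by blast
    then have "g ` D \<inter> U \<noteq> {}" using U gD t unfolding scott_open_def by blast
    then show "D \<inter> {m \<in> Field M. g m \<in> U} \<noteq> {}" using DF by blast
  qed
  then show ?thesis
    using g(1)
    by (auto simp: continuous_map_def topspace_scott_topology LP M openin_scott_topology)
qed

text \<open>
  This is the surjectivity of \<open>g\<close>: the up-closure of the compact set \<open>g ` K\<close>, where
  \<open>K = \<phi> (\<up>l)\<close>, is a member of \<open>\<Q> L\<close> that contains \<open>\<up>l\<close>.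
\<close>

lemma image_of_principal:
  assumes q: "quasicontinuous_domain L" and M: "Partial_order M"
    and bij: "bij_betw \<phi> (compact_saturated L) (compact_saturated M)"
    and mono: "\<And>A B. A \<in> compact_saturated L \<Longrightarrow> B \<in> compact_saturated L \<Longrightarrow> \<phi> A \<subseteq> \<phi> B \<longleftrightarrow> A \<subseteq> B"
    and l: "l \<in> Field L"
  shows "\<exists>m\<in>Field M. \<phi> (L `` {l}) = M `` {m}"
proof -
  note L = quasicontinuous_domainD(1)[OF q]
  have cs: "L `` {x} \<in> compact_saturated L" if "x \<in> Field L" for x
    using finite_up_closure_compact_saturated[OF L, of "{x}"] that by simp
  have \<phi>: "\<phi> ` compact_saturated L \<subseteq> compact_saturated M" using bij by (simp add: bij_betw_def)
  have "\<forall>m\<in>Field M. \<exists>x\<in>Field L. \<phi> (L `` {x}) = M `` {m}"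
    using preimage_of_principal[OF q M bij mono] by blast
  then obtain g where g: "\<And>m. m \<in> Field M \<Longrightarrow> g m \<in> Field L"
      "\<And>m. m \<in> Field M \<Longrightarrow> \<phi> (L `` {g m}) = M `` {m}"
    by metis
  define K where "K = \<phi> (L `` {l})"
  have K: "K \<in> compact_saturated M" using \<phi> cs[OF l] by (auto simp: K_def)
  have KF: "K \<subseteq> Field M" using compact_saturated_subset_Field[OF M K] .
  define A where "A = L `` (g ` K)"
  have "continuous_map (scott_topology M) (scott_topology L) g"
    using q by (intro scott_continuous_principal_transfer[OF _ M mono \<phi> g])
      (simp_all add: quasicontinuous_domain_def)
  moreover have "compactin (scott_topology M) K"
    using K by (simp add: compact_saturated_def)
  ultimately have "compactin (scott_topology L) (g ` K)" by (simp add: image_compactin)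
  then have A: "A \<in> compact_saturated L" unfolding A_def by (rule compactin_up_closure[OF L])
  have "K \<subseteq> \<phi> A"
  proof
    fix m assume m: "m \<in> K"
    then have mF: "m \<in> Field M" using KF by blast
    have "L `` {g m} \<subseteq> A" using m by (auto simp: A_def)
    then have "M `` {m} \<subseteq> \<phi> A" using mono[OF cs[OF g(1)[OF mF]] A] g(2)[OF mF] by simp
    then show "m \<in> \<phi> A" using Partial_order_refl[OF M mF] by blast
  qed
  then have "L `` {l} \<subseteq> A" using mono cs[OF l] A by (simp add: K_def)
  then obtain m where m: "m \<in> K" "(g m, l) \<in> L"
    using Partial_order_refl[OF L l] by (auto simp: A_def)
  then have mF: "m \<in> Field M" using KF by blast
  have "M `` {m} \<subseteq> K" by (rule principal_subset_upper[OF compact_saturated_upper[OF K] m(1)])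
  then have "L `` {g m} \<subseteq> L `` {l}"
    using mono[OF cs[OF g(1)[OF mF]] cs[OF l]] g(2)[OF mF] by (simp add: K_def)
  moreover have "L `` {l} \<subseteq> L `` {g m}" using m(2) principal_subset_iff[OF L l] by blast
  ultimately have "L `` {g m} = L `` {l}" by (rule subset_antisym)
  then show ?thesis using g(2)[OF mF] mF by auto
qed

theorem proposition3p10:
  fixes L :: "'a rel" and M :: "'b rel"
  assumes "quasicontinuous_domain L"
    and "Partial_order M"
    and "order_isomorphic (\<Q> L) (\<Q> M)"
  shows "order_isomorphic L M"
proof -
  note L = quasicontinuous_domainD(1)[OF assms(1)] and M = assms(2)
  obtain \<phi> where bij: "bij_betw \<phi> (compact_saturated L) (compact_saturated M)"
    and iso: "\<And>A B. A \<in> compact_saturated L \<Longrightarrow> B \<in> compact_saturated L \<Longrightarrow>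
      (A, B) \<in> \<Q> L \<longleftrightarrow> (\<phi> A, \<phi> B) \<in> \<Q> M"
    using assms(3) unfolding order_isomorphic_iff Field_\<Q> by blast
  have mono: "\<phi> A \<subseteq> \<phi> B \<longleftrightarrow> A \<subseteq> B"
    if "A \<in> compact_saturated L" "B \<in> compact_saturated L" for A B
    using iso[OF that(2,1)] that bij by (auto simp: \<Q>_def bij_betw_def)
  have cs: "L `` {x} \<in> compact_saturated L" if "x \<in> Field L" for x
    using finite_up_closure_compact_saturated[OF L, of "{x}"] that by simp
  have "\<forall>l\<in>Field L. \<exists>m\<in>Field M. \<phi> (L `` {l}) = M `` {m}"
    using image_of_principal[OF assms(1) M bij mono] by blast
  then obtain f where f: "\<And>l. l \<in> Field L \<Longrightarrow> f l \<in> Field M"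
      "\<And>l. l \<in> Field L \<Longrightarrow> \<phi> (L `` {l}) = M `` {f l}"
    by metis
  have f_iff: "(x, y) \<in> L \<longleftrightarrow> (f x, f y) \<in> M" if "x \<in> Field L" "y \<in> Field L" for x y
    using mono[OF cs[OF that(2)] cs[OF that(1)]] f that
    by (simp add: principal_subset_iff L M)
  have "inj_on f (Field L)"
    using f_iff Partial_order_antisym[OF L] Partial_order_refl[OF M] f(1)
    by (metis inj_onI)
  moreover have "f ` Field L = Field M"
  proof
    show "f ` Field L \<subseteq> Field M" using f(1) by blast
    show "Field M \<subseteq> f ` Field L"
    proof
      fix m assume m: "m \<in> Field M"
      then obtain l where l: "l \<in> Field L" "\<phi> (L `` {l}) = M `` {m}"
        using preimage_of_principal[OF assms(1) M bij mono] by blast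
      then have "M `` {f l} = M `` {m}" using f(2) by simp
      then have "f l = m"
        using principal_subset_iff[OF M] Partial_order_antisym[OF M] f(1)[OF l(1)] m
        by (metis order_refl)
      with l(1) show "m \<in> f ` Field L" by blast
    qed
  qed
  ultimately show ?thesis
    using f_iff unfolding order_isomorphic_iff bij_betw_def by blast
qed

end
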